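(* Let $m\ge 1$ be an integer, let $\ell$ be an odd integer, and let $J$, $A$, $B$, $C$, $s$, $u$, $\phi$, $\varphi$ be as defined in the context. For all $n,t\in\mathbb{Z}$ the following identities hold in $J$: $$[C^n,A^t]=A^{-2s\ell nt-4u\ell^2\phi(n)t},$$ $$[C^n,B^t]=B^{2s\ell nt-4u\ell^2\phi(n+1)t},$$ $$[A^n,B^t]=A^{-2s\ell\phi(n)t}\,B^{2s\ell n\phi(t)}\,C^{nt-2s\ell\phi(n)\phi(t)}\,A^{\xi_1(n,t)},$$ where $$\xi_1(n,t)=2u\ell^2\{2\varphi(n+1)t+(2n-7)\phi(n)\phi(t)-2n\phi(t)-(3n+1)n\varphi(t)\}.$$
   Context: Notation: $[a,b]=a^{-1}b^{-1}ab$, $b^a=a^{-1}ba$, $\alpha=1+2^m\ell$, $s=2^{m-1}$, $u=s^2$. The group is $$J=\langle A,B\mid A^{[A,B]}=A^{\alpha},\ B^{[B,A]}=B^{\alpha},\ A^{2^{3m-1}}=B^{2^{3m-1}}=1\rangle,\qquad C=[A,B].$$ For $n\in\mathbb{Z}$, $\phi(n)=\frac{(n-1)n}{2}$ and $\varphi(n)=\frac{n(n-1)(n-2)}{6}$. *)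

theory Defs
  imports "HOL-Algebra.Coset"
begin

text \<open>A word is a list of letters; the letter \<open>(g, True)\<close> stands for the generator \<open>g\<close>
  and \<open>(g, False)\<close> for its formal inverse.\<close>

type_synonym 'g word = "('g \<times> bool) list"

inductive word_eq :: "'g word \<Rightarrow> 'g word \<Rightarrow> bool" where
  refl: "word_eq v v"
| sym: "word_eq v w \<Longrightarrow> word_eq w v"
| trans: "word_eq u v \<Longrightarrow> word_eq v w \<Longrightarrow> word_eq u w"
| cancel: "word_eq (v @ [(g, b), (g, \<not> b)] @ w) (v @ w)"

definition word_class :: "'g word \<Rightarrow> 'g word set" where
  "word_class v = {w. word_eq v w}"

text \<open>The free group on the whole type \<open>'g\<close>.\<close>

definition free_group :: "'g word set monoid" where
  "free_group =
    \<lparr>carrier = range word_class,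
     mult = (\<lambda>V W. \<Union>v\<in>V. \<Union>w\<in>W. word_class (v @ w)),
     one = word_class []\<rparr>"

definition free_gen :: "'g \<Rightarrow> 'g word set" where
  "free_gen g = word_class [(g, True)]"

lemma word_eq_append_right: "word_eq v w \<Longrightarrow> word_eq (v @ z) (w @ z)"
proof (induction rule: word_eq.induct)
  case (cancel v g b w)
  show ?case using word_eq.cancel[of v g b "w @ z"] by simp
qed (simp_all add: word_eq.refl word_eq.sym, metis word_eq.trans)

lemma word_eq_append_left: "word_eq v w \<Longrightarrow> word_eq (z @ v) (z @ w)"
proof (induction rule: word_eq.induct)
  case (cancel v g b w)
  show ?case using word_eq.cancel[of "z @ v" g b w] by simp
qed (simp_all add: word_eq.refl word_eq.sym, metis word_eq.trans)

lemma word_eq_append: "word_eq v v' \<Longrightarrow> word_eq w w' \<Longrightarrow> word_eq (v @ w) (v' @ w')"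
  by (meson word_eq.trans word_eq_append_left word_eq_append_right)

lemma word_class_eq_iff: "word_class v = word_class w \<longleftrightarrow> word_eq v w"
  unfolding word_class_def set_eq_iff mem_Collect_eq by (meson word_eq.refl word_eq.sym word_eq.trans)

lemma free_group_mult:
  "word_class v \<otimes>\<^bsub>free_group\<^esub> word_class w = word_class (v @ w)"
proof -
  have "word_class (x @ y) = word_class (v @ w)"
    if "x \<in> word_class v" "y \<in> word_class w" for x y
    using that unfolding word_class_eq_iff
    by (simp add: word_class_def word_eq.sym word_eq_append)
  moreover have "v \<in> word_class v" "w \<in> word_class w"
    by (simp_all add: word_class_def word_eq.refl)
  ultimately have "(\<Union>x\<in>word_class v. \<Union>y\<in>word_class w. word_class (x @ y))
      = word_class (v @ w)"
    by blast
  then show ?thesis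
    by (simp add: free_group_def)
qed

lemma free_group_one: "\<one>\<^bsub>free_group\<^esub> = word_class []"
  by (simp add: free_group_def)

lemma free_group_carrier: "carrier free_group = range word_class"
  by (simp add: free_group_def)

lemma free_gen_closed: "free_gen g \<in> carrier free_group"
  by (simp add: free_gen_def free_group_carrier)

lemma word_eq_inverse: "word_eq (rev (map (\<lambda>(g, b). (g, \<not> b)) v) @ v) []"
proof (induction v)
  case Nil
  show ?case by (simp add: word_eq.refl)
next
  case (Cons x v)
  obtain g b where x: "x = (g, b)" by (cases x)
  show ?case
    using word_eq.trans[OF word_eq.cancel[of "rev (map (\<lambda>(g, b). (g, \<not> b)) v)" g "\<not> b" v] Cons.IH]
    by (simp add: x)
qed

lemma group_free_group: "group (free_group :: 'g word set monoid)"
proof (rule groupI)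
  fix x :: "'g word set"
  assume "x \<in> carrier free_group"
  then obtain v where "x = word_class v"
    by (auto simp: free_group_carrier)
  then have "word_class (rev (map (\<lambda>(g, b). (g, \<not> b)) v)) \<otimes>\<^bsub>free_group\<^esub> x
      = \<one>\<^bsub>free_group\<^esub>"
    by (simp only: free_group_mult free_group_one word_class_eq_iff word_eq_inverse)
  then show "\<exists>y\<in>carrier free_group. y \<otimes>\<^bsub>free_group\<^esub> x = \<one>\<^bsub>free_group\<^esub>"
    by (auto simp: free_group_carrier)
qed (auto simp: free_group_carrier free_group_mult free_group_one)

text \<open>If \<open>R\<close> is a subset of the carrier, then the carrier itself is one of the intersected
  subgroups; the explicit intersection only matters for other \<open>R\<close>.\<close>

definition normal_closure :: "('a, 'b) monoid_scheme \<Rightarrow> 'a set \<Rightarrow> 'a set" where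
  "normal_closure G R = carrier G \<inter> \<Inter>{N. N \<lhd> G \<and> R \<subseteq> N}"

definition presented_group :: "'g word set set \<Rightarrow> 'g word set set monoid" where
  "presented_group R = free_group Mod normal_closure free_group R"

definition presented_gen :: "'g word set set \<Rightarrow> 'g \<Rightarrow> 'g word set set" where
  "presented_gen R g = normal_closure free_group R #>\<^bsub>free_group\<^esub> free_gen g"

lemma (in group) normal_carrier: "carrier G \<lhd> G"
  by (simp add: normal_inv_iff subgroup_self)

lemma (in group) normal_normal_closure:
  assumes "R \<subseteq> carrier G"
  shows "normal_closure G R \<lhd> G"
proof -
  let ?\<N> = "{N. N \<lhd> G \<and> R \<subseteq> N}"
  have mem: "carrier G \<in> ?\<N>"
    using assms normal_carrier by simp
  then have eq: "normal_closure G R = \<Inter>?\<N>"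
    unfolding normal_closure_def by blast
  have "subgroup (\<Inter>?\<N>) G"
    by (rule subgroups_Inter) (use mem in \<open>auto simp: normal_imp_subgroup\<close>)
  then show ?thesis
    unfolding eq normal_inv_iff using normal_inv_iff by auto
qed

lemma group_presented_group:
  assumes "R \<subseteq> carrier free_group"
  shows "group (presented_group R)"
  unfolding presented_group_def
  by (intro normal.factorgroup_is_group group.normal_normal_closure group_free_group assms)

lemma presented_gen_closed: "presented_gen R g \<in> carrier (presented_group R)"
  unfolding presented_gen_def presented_group_def FactGroup_def RCOSETS_def
  using free_gen_closed[of g] by auto

text \<open>The convention is \<open>[a, b] = a\<^sup>-\<^sup>1 b\<^sup>-\<^sup>1 a b\<close> and \<open>b\<^sup>a = a\<^sup>-\<^sup>1 b a\<close>.\<close>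

definition commutator :: "('a, 'b) monoid_scheme \<Rightarrow> 'a \<Rightarrow> 'a \<Rightarrow> 'a" where
  "commutator G a b = inv\<^bsub>G\<^esub> a \<otimes>\<^bsub>G\<^esub> inv\<^bsub>G\<^esub> b \<otimes>\<^bsub>G\<^esub> a \<otimes>\<^bsub>G\<^esub> b"

definition conjugate_by :: "('a, 'b) monoid_scheme \<Rightarrow> 'a \<Rightarrow> 'a \<Rightarrow> 'a" where
  "conjugate_by G b a = inv\<^bsub>G\<^esub> a \<otimes>\<^bsub>G\<^esub> b \<otimes>\<^bsub>G\<^esub> a"

datatype gen = Gen_A | Gen_B

definition alpha :: "nat \<Rightarrow> int \<Rightarrow> int" where
  "alpha m l = 1 + 2 ^ m * l"

text \<open>A defining relation \<open>x = y\<close> becomes the relator \<open>x y\<^sup>-\<^sup>1\<close>.\<close>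

definition J_relators :: "nat \<Rightarrow> int \<Rightarrow> gen word set set" where
  "J_relators m l =
    (let F = free_group; a = free_gen Gen_A; b = free_gen Gen_B in
      {conjugate_by F a (commutator F a b) \<otimes>\<^bsub>F\<^esub> inv\<^bsub>F\<^esub> (a [^]\<^bsub>F\<^esub> alpha m l),
       conjugate_by F b (commutator F b a) \<otimes>\<^bsub>F\<^esub> inv\<^bsub>F\<^esub> (b [^]\<^bsub>F\<^esub> alpha m l),
       a [^]\<^bsub>F\<^esub> ((2::nat) ^ (3 * m - 1)),
       b [^]\<^bsub>F\<^esub> ((2::nat) ^ (3 * m - 1))})"

definition J_group :: "nat \<Rightarrow> int \<Rightarrow> gen word set set monoid" where
  "J_group m l = presented_group (J_relators m l)"

definition J_A :: "nat \<Rightarrow> int \<Rightarrow> gen word set set" where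
  "J_A m l = presented_gen (J_relators m l) Gen_A"

definition J_B :: "nat \<Rightarrow> int \<Rightarrow> gen word set set" where
  "J_B m l = presented_gen (J_relators m l) Gen_B"

definition J_C :: "nat \<Rightarrow> int \<Rightarrow> gen word set set" where
  "J_C m l = commutator (J_group m l) (J_A m l) (J_B m l)"

lemma J_relators_closed: "J_relators m l \<subseteq> carrier free_group"
proof -
  interpret F: group "free_group :: gen word set monoid"
    by (rule group_free_group)
  show ?thesis
    by (simp add: J_relators_def Let_def conjugate_by_def commutator_def free_gen_closed)
qed

lemma group_J_group: "group (J_group m l)"
  unfolding J_group_def by (intro group_presented_group J_relators_closed)

text \<open>The integer divisions in the next two definitions are exact.\<close>

definition phi :: "int \<Rightarrow> int" where
  "phi n = (n - 1) * n div 2"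

definition varphi :: "int \<Rightarrow> int" where
  "varphi n = n * (n - 1) * (n - 2) div 6"

lemma two_phi: "2 * phi n = (n - 1) * n"
  unfolding phi_def by simp

lemma six_varphi: "6 * varphi n = n * (n - 1) * (n - 2)"
proof -
  have "2 dvd n * (n - 1) * (n - 2)" by simp
  moreover have "3 dvd n * (n - 1) * (n - 2)"
  proof -
    have "3 dvd n \<or> 3 dvd n - 1 \<or> 3 dvd n - 2" by presburger
    then show ?thesis by (metis dvd_mult dvd_mult2)
  qed
  ultimately have "2 * 3 dvd n * (n - 1) * (n - 2)"
    by (intro divides_mult) simp_all
  then show ?thesis unfolding varphi_def by simp
qed

definition xi1 :: "nat \<Rightarrow> int \<Rightarrow> int \<Rightarrow> int \<Rightarrow> int" where
  "xi1 m l n t =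
    (let s = 2 ^ (m - 1); u = s ^ 2 in
      2 * u * l ^ 2 *
        (2 * varphi (n + 1) * t + (2 * n - 7) * phi n * phi t
          - 2 * n * phi t - (3 * n + 1) * n * varphi t))"

end

theory Submission
  imports Defs
begin

text \<open>Why the identities hold. Put \<open>N = 4 s\<^sup>3 = 2 ^ (3 m - 1)\<close>, so that exponents of \<open>A\<close> and \<open>B\<close>
  matter only modulo \<open>N\<close>. Conjugation by \<open>C ^ n\<close> raises \<open>A\<close> to the power \<open>\<alpha> ^ n\<close>, and modulo \<open>N\<close>
  the binomial expansion of \<open>\<alpha> ^ n = (1 + 2 s l) ^ n\<close> stops after the quadratic term. This
  is \<open>conj_exp\<close>, and it gives the first identity; the second is the same statement for
  \<open>B\<close> and \<open>C\<^sup>-\<^sup>1\<close>, since \<open>[B, A] = C\<^sup>-\<^sup>1\<close> makes the presentation symmetric under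
  \<open>A \<leftrightarrow> B\<close>, \<open>C \<leftrightarrow> C\<^sup>-\<^sup>1\<close>.

  For the third identity, \<open>A ^ B = A C\<close> and \<open>B ^ A = B C\<^sup>-\<^sup>1\<close>. Summing a geometric progression
  of powers of \<open>\<alpha>\<^sup>-\<^sup>1\<close> gives \<open>(A C ^ t) ^ n\<close> (\<open>mult_pow\<close>), and from the conjugate of \<open>B ^ t\<close> by \<open>A\<close>
  one reads off \<open>A ^ (B ^ t) = A C ^ t Y z'\<close>, where \<open>Y = B ^ (2 s l \<phi>(t))\<close> and \<open>z'\<close> is a power of
  \<open>B ^ (4 s\<^sup>2 l\<^sup>2)\<close> (\<open>a_conj_b_pow\<close>). It remains to raise this to the power \<open>n\<close>.

  What makes that possible is the relation \<open>A ^ (2 s\<^sup>2 l\<^sup>2) = B ^ (- 2 s\<^sup>2 l\<^sup>2)\<close> (\<open>z_eq_b_pow\<close>),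
  found by computing \<open>A ^ (B ^ \<alpha>)\<close> in two ways, once as above and once through
  \<open>B ^ \<alpha> = C B C\<^sup>-\<^sup>1\<close>. Hence \<open>z = A ^ (2 s\<^sup>2 l\<^sup>2)\<close> is central. Modulo powers of \<open>z\<close> the commutator
  \<open>W = [Y, A C ^ t]\<close> is a power of \<open>C ^ (2 s l)\<close>; it commutes with \<open>Y\<close>, and its commutator with \<open>A C ^ t\<close>
  is a power of \<open>z\<close>. So \<open>A C ^ t\<close> and \<open>Y\<close> generate a group of class at most three in which the power of
  a product is collected with binomial exponents (\<open>int_pow_mult_collect\<close>). Multiplying out
  leaves a power of \<open>z\<close> whose exponent is a polynomial in \<open>n\<close> and \<open>t\<close>, and that polynomial is
  the one that defines \<open>xi1\<close>.\<close>

section \<open>Integer powers in groups\<close>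

text \<open>A two-sided induction: because \<open>g\<close> can be cancelled, the recurrence determines \<open>F\<close> at
  negative arguments as well, so that every power formula below needs only its upward step.\<close>

lemma (in group) int_pow_eqI:
  fixes F :: "int \<Rightarrow> 'a"
  assumes g: "g \<in> carrier G" and F: "\<And>n. F n \<in> carrier G"
    and zero: "F 0 = \<one>" and step: "\<And>n. F (n + 1) = F n \<otimes> g"
  shows "g [^] n = F n"
proof (induction n rule: int_induct[where k = 0])
  case base
  show ?case by (simp add: zero)
next
  case (step1 i)
  show ?case using step1 by (simp add: int_pow_mult g step)
next
  case (step2 i)
  have "g [^] (i - 1) \<otimes> g = g [^] i"
    using int_pow_mult[OF g, of "i - 1" 1] g by simp
  also have "\<dots> = F (i - 1) \<otimes> g"
    using step2 step[of "i - 1"] by simp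
  finally show ?case using g F by simp
qed

lemma (in group) int_pow_conj:
  fixes i :: int
  assumes "x \<in> carrier G" "y \<in> carrier G" "g \<in> carrier G" and "x \<otimes> g = g \<otimes> y"
  shows "x [^] i \<otimes> g = g \<otimes> y [^] i"
proof -
  have "y [^] i = inv g \<otimes> (x [^] i \<otimes> g)"
  proof (rule int_pow_eqI)
    fix n :: int
    show "inv g \<otimes> (x [^] (n + 1) \<otimes> g) = inv g \<otimes> (x [^] n \<otimes> g) \<otimes> y"
      using assms by (simp add: int_pow_mult m_assoc)
  qed (use assms in auto)
  then show ?thesis using assms by (simp add: inv_solve_left)
qed

lemma (in group) int_pow_commute:
  fixes i j :: int
  assumes "x \<in> carrier G" "y \<in> carrier G" and "x \<otimes> y = y \<otimes> x"
  shows "x [^] i \<otimes> y [^] j = y [^] j \<otimes> x [^] i"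
  using assms by (metis int_pow_closed int_pow_conj)

lemma (in group) int_pow_cong:
  fixes i j N :: int
  assumes "x \<in> carrier G" "x [^] N = \<one>" and "N dvd i - j"
  shows "x [^] i = x [^] j"
proof -
  obtain q where "i = j + N * q" using assms(3) by (metis dvdE diff_eq_eq add.commute)
  then show ?thesis using assms by (simp add: int_pow_mult flip: int_pow_pow)
qed

section \<open>Binomial polynomials\<close>

lemma phi_add: "phi (i + j) = phi i + phi j + i * j"
  using two_phi[of "i + j"] two_phi[of i] two_phi[of j] by (simp add: algebra_simps)

lemma phi_one [simp]: "phi 1 = 0" and phi_zero [simp]: "phi 0 = 0"
  by (simp_all add: phi_def)

lemma varphi_zero [simp]: "varphi 0 = 0" by (simp add: varphi_def)

lemma phi_Suc: "phi (n + 1) = phi n + n"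
  by (simp add: phi_add)

lemma varphi_Suc: "varphi (n + 1) = varphi n + phi n"
  using six_varphi[of n] six_varphi[of "n + 1"] two_phi[of n]
  by (simp add: algebra_simps)

section \<open>Collecting the power of a product\<close>

text \<open>Here \<open>W = [Y, X]\<close> and \<open>Z = [W, X]\<close>. Moving one more \<open>X\<close> to the left past \<open>Y ^ n W ^ k Z ^ j\<close> turns
  this into \<open>Y ^ n W ^ (k + n) Z ^ (j + k)\<close>, so the exponents satisfy the recurrences of the binomial
  coefficients \<open>n\<close> over two and \<open>n\<close> over three.\<close>

lemma (in group) int_pow_mult_collect:
  fixes n :: int
  assumes X: "X \<in> carrier G" and Y: "Y \<in> carrier G" and W: "W \<in> carrier G" and Z: "Z \<in> carrier G"
    and YX: "Y \<otimes> X = X \<otimes> (Y \<otimes> W)" and WY: "W \<otimes> Y = Y \<otimes> W"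
    and WX: "W \<otimes> X = X \<otimes> (W \<otimes> Z)"
    and ZX: "Z \<otimes> X = X \<otimes> Z" and ZY: "Z \<otimes> Y = Y \<otimes> Z" and ZW: "Z \<otimes> W = W \<otimes> Z"
  shows "(X \<otimes> Y) [^] n = X [^] n \<otimes> (Y [^] n \<otimes> (W [^] phi n \<otimes> Z [^] varphi n))"
proof (rule int_pow_eqI)
  fix n :: int
  have YnX: "Y [^] n \<otimes> X = X \<otimes> (Y [^] n \<otimes> W [^] n)"
    using int_pow_conj[of Y "Y \<otimes> W" X n] assms by (simp add: int_pow_mult_distrib)
  have WnX: "W [^] k \<otimes> X = X \<otimes> (W [^] k \<otimes> Z [^] k)" for k :: int
    using int_pow_conj[of W "W \<otimes> Z" X k] assms by (simp add: int_pow_mult_distrib)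
  have ZnX: "Z [^] k \<otimes> X = X \<otimes> Z [^] k" for k :: int
    using int_pow_conj assms by simp
  have Wnk: "W [^] k \<otimes> W [^] j = W [^] (k + j)" "Z [^] k \<otimes> Z [^] j = Z [^] (k + j)" for k j :: int
    using int_pow_mult assms by simp_all
  have com: "W [^] k \<otimes> Y = Y \<otimes> W [^] k" "Z [^] k \<otimes> Y = Y \<otimes> Z [^] k" for k :: int
    using int_pow_conj assms by simp_all
  let ?w = "phi n" and ?z = "varphi n"
  have "X [^] n \<otimes> (Y [^] n \<otimes> (W [^] ?w \<otimes> Z [^] ?z)) \<otimes> (X \<otimes> Y)
      = X [^] n \<otimes> (Y [^] n \<otimes> (W [^] ?w \<otimes> ((Z [^] ?z \<otimes> X) \<otimes> Y)))"
    using assms by (simp add: m_assoc)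
  also have "\<dots> = X [^] n \<otimes> (Y [^] n \<otimes> ((W [^] ?w \<otimes> X) \<otimes> (Z [^] ?z \<otimes> Y)))"
    unfolding ZnX using assms by (simp add: m_assoc)
  also have "\<dots> = X [^] n \<otimes> ((Y [^] n \<otimes> X) \<otimes> (W [^] ?w \<otimes> Z [^] ?w \<otimes> (Z [^] ?z \<otimes> Y)))"
    unfolding WnX using assms by (simp add: m_assoc)
  also have "\<dots> = (X [^] n \<otimes> X) \<otimes> (Y [^] n \<otimes> ((W [^] n \<otimes> W [^] ?w) \<otimes> ((Z [^] ?w \<otimes> Z [^] ?z) \<otimes> Y)))"
    unfolding YnX using assms by (simp add: m_assoc)
  also have "\<dots> = X [^] (n + 1) \<otimes> (Y [^] n \<otimes> (W [^] (n + ?w) \<otimes> (Z [^] (?w + ?z) \<otimes> Y)))"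
    unfolding Wnk using X by (simp add: int_pow_mult[of X])
  also have "\<dots> = X [^] (n + 1) \<otimes> (Y [^] n \<otimes> ((W [^] (n + ?w) \<otimes> Y) \<otimes> Z [^] (?w + ?z)))"
    unfolding com(2) using assms by (simp add: m_assoc)
  also have "\<dots> = X [^] (n + 1) \<otimes> (Y [^] (n + 1) \<otimes> (W [^] (n + ?w) \<otimes> Z [^] (?w + ?z)))"
    unfolding com(1) using assms by (simp add: m_assoc int_pow_mult[of Y])
  finally show "X [^] (n + 1) \<otimes> (Y [^] (n + 1) \<otimes> (W [^] phi (n + 1) \<otimes> Z [^] varphi (n + 1)))
     = X [^] n \<otimes> (Y [^] n \<otimes> (W [^] ?w \<otimes> Z [^] ?z)) \<otimes> (X \<otimes> Y)"
    unfolding phi_Suc varphi_Suc by (simp add: add.commute)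
qed (use assms in auto)

section \<open>An element raised to the power \<open>1 + 2 s l\<close> by conjugation\<close>

text \<open>The binomial expansion of \<open>(1 + 2 s l) ^ n\<close>, cut off after the quadratic term; the omitted terms
  are multiples of \<open>4 s\<^sup>3\<close>. Unlike the power it is an integer also for negative \<open>n\<close>.\<close>

definition conj_exp :: "int \<Rightarrow> int \<Rightarrow> int \<Rightarrow> int" where
  "conj_exp s l n = 1 + 2 * s * l * n + 4 * s ^ 2 * l ^ 2 * phi n"

text \<open>The sum of \<open>conj_exp s l (- t * i)\<close> over \<open>0 \<le> i < n\<close>, continued to all integers \<open>n\<close>: the exponent
  of \<open>x\<close> when \<open>(x g ^ t) ^ n\<close> is written as a power of \<open>x\<close> times a power of \<open>g\<close>.\<close>

definition power_exp :: "int \<Rightarrow> int \<Rightarrow> int \<Rightarrow> int \<Rightarrow> int" where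
  "power_exp s l t n =
    n - 2 * s * l * t * phi n + 4 * s ^ 2 * l ^ 2 * (t ^ 2 * varphi n + phi (t + 1) * phi n)"

lemma power_exp_Suc: "power_exp s l t (n + 1) = power_exp s l t n + conj_exp s l (- (t * n))"
proof -
  have "phi (- (t * n)) = t ^ 2 * phi n + phi (t + 1) * n"
  proof -
    have "2 * phi (- (t * n)) = (- (t * n) - 1) * - (t * n)" by (rule two_phi)
    also have "\<dots> = t ^ 2 * ((n - 1) * n) + (t + 1 - 1) * (t + 1) * n" by algebra
    also have "\<dots> = t ^ 2 * (2 * phi n) + 2 * phi (t + 1) * n" by (simp only: two_phi)
    finally show ?thesis by simp
  qed
  then show ?thesis
    unfolding power_exp_def conj_exp_def phi_Suc[of n] varphi_Suc by (simp add: algebra_simps)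
qed

locale scaled_conjugation = group +
  fixes x g :: 'a and s l :: int
  assumes x [simp]: "x \<in> carrier G" and g [simp]: "g \<in> carrier G"
    and conj: "x \<otimes> g = g \<otimes> x [^] (1 + 2 * s * l)"
    and x_pow: "x [^] (4 * s ^ 3) = \<one>"
begin

lemma pow_cong: "4 * s ^ 3 dvd i - j \<Longrightarrow> x [^] i = x [^] j" for i j :: int
  using int_pow_cong x x_pow by blast

text \<open>One conjugation by \<open>g\<close> multiplies the exponent by \<open>1 + 2 s l\<close>, which takes \<open>conj_exp s l n\<close>
  to \<open>conj_exp s l (n + 1)\<close> modulo \<open>4 s\<^sup>3\<close>.\<close>

lemma pow_conj_pow: "x [^] i \<otimes> g [^] n = g [^] n \<otimes> x [^] (i * conj_exp s l n)" for i n :: int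
proof -
  have step: "x [^] conj_exp s l n \<otimes> g = g \<otimes> x [^] conj_exp s l (n + 1)" for n
  proof -
    have "x [^] conj_exp s l n \<otimes> g = g \<otimes> x [^] ((1 + 2 * s * l) * conj_exp s l n)"
      using int_pow_conj[OF _ _ _ conj] by (simp add: int_pow_pow)
    also have "x [^] ((1 + 2 * s * l) * conj_exp s l n) = x [^] conj_exp s l (n + 1)"
    proof (rule pow_cong)
      have "(1 + 2 * s * l) * conj_exp s l n - conj_exp s l (n + 1) = 4 * s ^ 3 * (2 * l ^ 3 * phi n)"
        unfolding conj_exp_def phi_Suc by algebra
      then show "4 * s ^ 3 dvd (1 + 2 * s * l) * conj_exp s l n - conj_exp s l (n + 1)"
        by simp
    qed
    finally show ?thesis .
  qed
  \<comment> \<open>Solved for \<open>g ^ n\<close>, the claim becomes a recurrence in \<open>n\<close>, so negative \<open>n\<close> need no inverse of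
    \<open>1 + 2 s l\<close> modulo \<open>4 s\<^sup>3\<close>.\<close>
  have "g [^] n = inv x \<otimes> (g [^] n \<otimes> x [^] conj_exp s l n)"
  proof (rule int_pow_eqI)
    show "inv x \<otimes> (g [^] (0::int) \<otimes> x [^] conj_exp s l 0) = \<one>"
      by (simp add: conj_exp_def)
    show "inv x \<otimes> (g [^] (n + 1) \<otimes> x [^] conj_exp s l (n + 1))
        = inv x \<otimes> (g [^] n \<otimes> x [^] conj_exp s l n) \<otimes> g" for n
      by (simp add: int_pow_mult m_assoc step)
  qed auto
  then have "x \<otimes> g [^] n = g [^] n \<otimes> x [^] conj_exp s l n"
    by (metis inv_solve_left g x int_pow_closed m_closed)
  then have "x [^] i \<otimes> g [^] n = g [^] n \<otimes> (x [^] conj_exp s l n) [^] i"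
    by (intro int_pow_conj) auto
  then show ?thesis by (simp add: int_pow_pow mult.commute)
qed

lemma pow_pow_conj: "g [^] n \<otimes> x [^] i = x [^] (i * conj_exp s l (- n)) \<otimes> g [^] n" for i n :: int
proof -
  have "g [^] n \<otimes> x [^] i = g [^] n \<otimes> (x [^] i \<otimes> g [^] (- n)) \<otimes> g [^] n"
    by (simp add: m_assoc flip: int_pow_mult)
  also have "\<dots> = x [^] (i * conj_exp s l (- n)) \<otimes> g [^] n"
    unfolding pow_conj_pow[of i "- n"] by (simp flip: m_assoc int_pow_mult)
  finally show ?thesis .
qed

lemma mult_pow: "(x \<otimes> g [^] t) [^] n = x [^] power_exp s l t n \<otimes> g [^] (t * n)" for n t :: int
proof (rule int_pow_eqI)
  show "x [^] power_exp s l t 0 \<otimes> g [^] (t * 0) = \<one>"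
    by (simp add: power_exp_def)
next
  fix n :: int
  have "x [^] power_exp s l t n \<otimes> g [^] (t * n) \<otimes> (x \<otimes> g [^] t)
      = x [^] power_exp s l t n \<otimes> (g [^] (t * n) \<otimes> x [^] (1::int)) \<otimes> g [^] t"
    by (simp add: m_assoc)
  also have "\<dots> = x [^] power_exp s l t (n + 1) \<otimes> g [^] (t * (n + 1))"
    unfolding pow_pow_conj power_exp_Suc by (simp add: m_assoc int_pow_mult distrib_left)
  finally show "x [^] power_exp s l t (n + 1) \<otimes> g [^] (t * (n + 1))
     = x [^] power_exp s l t n \<otimes> g [^] (t * n) \<otimes> (x \<otimes> g [^] t)" by simp
qed auto

lemma commutator_pow: "commutator G (g [^] n) (x [^] t) = x [^] (t * (1 - conj_exp s l n))" for n t :: int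
proof -
  have "commutator G (g [^] n) (x [^] t) = g [^] (- n) \<otimes> (x [^] (- t) \<otimes> g [^] n) \<otimes> x [^] t"
    by (simp add: commutator_def int_pow_neg m_assoc)
  also have "\<dots> = x [^] (- t * conj_exp s l n + t)"
    unfolding pow_conj_pow by (simp add: int_pow_mult flip: m_assoc)
     (simp flip: int_pow_mult)
  finally show ?thesis by (simp add: algebra_simps)
qed

end

section \<open>The relation between powers of the two generators\<close>

text \<open>The relations of \<open>J\<close>, with a parameter \<open>s\<close> in place of the power of two. That \<open>s\<close> is prime to
  three lets a factor \<open>s\<close> survive the division by six in \<open>varphi\<close>.\<close>

locale macdonald_pair = group +
  fixes a b c :: 'a and s l :: int
  assumes a [simp]: "a \<in> carrier G" and b [simp]: "b \<in> carrier G"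
    and c_eq: "c = commutator G a b"
    and conj_a: "a \<otimes> c = c \<otimes> a [^] (1 + 2 * s * l)"
    and conj_b: "b \<otimes> inv c = inv c \<otimes> b [^] (1 + 2 * s * l)"
    and a_pow: "a [^] (4 * s ^ 3) = \<one>" and b_pow: "b [^] (4 * s ^ 3) = \<one>"
    and coprime_s_3: "coprime s 3"
begin

lemma c [simp]: "c \<in> carrier G"
  by (simp add: c_eq commutator_def)

sublocale A: scaled_conjugation G a c s l
  by unfold_locales (simp_all add: conj_a a_pow)

sublocale B: scaled_conjugation G b "inv c" s l
  by unfold_locales (simp_all add: conj_b b_pow)

lemma inv_c_pow: "inv c [^] i = c [^] (- i)" for i :: int
  by (simp add: int_pow_inv int_pow_neg)

lemma a_pow_b: "a [^] i \<otimes> b = b \<otimes> (a [^] power_exp s l 1 i \<otimes> c [^] i)" for i :: int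
proof -
  have "a \<otimes> b = b \<otimes> (a \<otimes> c)"
    by (simp add: c_eq commutator_def m_assoc inv_solve_left)
       (simp flip: m_assoc)
  from int_pow_conj[OF _ _ _ this, of i] show ?thesis
    using A.mult_pow[of 1 i] by simp
qed

lemma b_pow_a: "b [^] i \<otimes> a = a \<otimes> (b [^] power_exp s l 1 i \<otimes> c [^] (- i))" for i :: int
proof -
  have "b \<otimes> a = a \<otimes> (b \<otimes> inv c)"
    by (simp add: c_eq commutator_def m_assoc inv_mult_group)
       (simp flip: m_assoc)
  from int_pow_conj[OF _ _ _ this, of i] show ?thesis
    using B.mult_pow[of 1 i] by (simp add: inv_c_pow[of i])
qed

text \<open>This is \<open>a ^ (b ^ i) = a [a, b ^ i]\<close> with the commutator read off from the conjugate of \<open>b ^ i\<close> by \<open>a\<close>,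
  a formula that is already closed in \<open>i\<close>; conjugating \<open>a\<close> by \<open>b\<close> repeatedly would
  require the conjugates of \<open>c\<close> as well.\<close>

lemma a_b_pow: "a \<otimes> b [^] i = b [^] i \<otimes> (a \<otimes> c [^] i \<otimes> b [^] (i - power_exp s l 1 i))" for i :: int
proof -
  have "b [^] i \<otimes> (a \<otimes> c [^] i \<otimes> b [^] (i - power_exp s l 1 i))
      = (b [^] i \<otimes> a) \<otimes> c [^] i \<otimes> b [^] (i - power_exp s l 1 i)"
    by (simp add: m_assoc)
  also have "\<dots> = a \<otimes> (b [^] power_exp s l 1 i \<otimes> (c [^] (- i) \<otimes> c [^] i) \<otimes> b [^] (i - power_exp s l 1 i))"
    unfolding b_pow_a by (simp add: m_assoc)
  also have "\<dots> = a \<otimes> b [^] i"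
    by (simp flip: int_pow_mult)
  finally show ?thesis by simp
qed

lemma power_exp_1:
  "power_exp s l 1 n = n - 2 * s * l * phi n + 4 * s ^ 2 * l ^ 2 * (varphi n + phi n)"
proof -
  have "phi 2 = 1" by (simp add: phi_def)
  then show ?thesis by (simp add: power_exp_def)
qed

text \<open>The product of three consecutive integers in the assumption is six times
  \<open>varphi n + phi n = varphi (n + 1)\<close>; the factor two is cancelled, and \<open>s\<close> is prime to three.\<close>

lemma s_dvd_varphi:
  assumes "n * (n + 1) * (n - 1) = 2 * s * w"
  obtains v where "varphi n + phi n = s * v"
proof -
  have "6 * (varphi n + phi n) = n * (n + 1) * (n - 1)"
    using six_varphi[of n] two_phi[of n] by algebra
  then have "3 * (varphi n + phi n) = s * w" using assms by simp
  then have "s dvd 3 * (varphi n + phi n)" by simp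
  then have "s dvd varphi n + phi n"
    using coprime_s_3 coprime_dvd_mult_right_iff by blast
  then show ?thesis using that by (elim dvdE)
qed

definition z where "z = a [^] (2 * s ^ 2 * l ^ 2)"

lemma z [simp]: "z \<in> carrier G"
  by (simp add: z_def)

text \<open>Let \<open>\<alpha> = 1 + 2 s l\<close> and compare two expressions for \<open>a ^ (b ^ \<alpha>)\<close>. On the one hand it is given by \<open>a_b_pow\<close>. On the other hand
  \<open>b ^ \<alpha> = c b c\<^sup>-\<^sup>1\<close>, and conjugation by \<open>c b c\<^sup>-\<^sup>1\<close> takes \<open>a\<close> through \<open>a ^ \<alpha>\<close> and \<open>(a c) ^ \<alpha>\<close> to
  a power of \<open>a\<close> times \<open>c ^ \<alpha>\<close>. The powers of \<open>c\<close> cancel, and what is left equates a power of \<open>b\<close>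
  with a power of \<open>a\<close>. Modulo \<open>4 s\<^sup>3\<close> the two exponents are \<open>2 s\<^sup>2 l\<^sup>2\<close> and \<open>- 2 s\<^sup>2 l\<^sup>2\<close>.\<close>

lemma z_eq_b_pow: "z = b [^] (- (2 * s ^ 2 * l ^ 2))"
proof -
  let ?\<alpha> = "1 + 2 * s * l"
  let ?S = "power_exp s l 1 ?\<alpha>"
  have b_\<alpha>: "b [^] ?\<alpha> = c \<otimes> b \<otimes> inv c"
    by (simp add: m_assoc conj_b) (simp flip: m_assoc)
  have "b [^] ?\<alpha> \<otimes> (a \<otimes> c [^] ?\<alpha> \<otimes> b [^] (?\<alpha> - ?S)) = a \<otimes> (c \<otimes> b \<otimes> inv c)"
    unfolding b_\<alpha>[symmetric] by (rule a_b_pow[symmetric])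
  also have "\<dots> = c \<otimes> (a [^] ?\<alpha> \<otimes> b) \<otimes> inv c"
    by (simp add: conj_a flip: m_assoc)
  also have "\<dots> = (c \<otimes> b \<otimes> inv c) \<otimes> (c [^] (1::int) \<otimes> a [^] ?S) \<otimes> (c [^] ?\<alpha> \<otimes> c [^] (-1::int))"
    unfolding a_pow_b by (simp add: m_assoc int_pow_neg) (simp flip: m_assoc)
  also have "\<dots> = b [^] ?\<alpha> \<otimes> (a [^] (?S * conj_exp s l (-1)) \<otimes> (c [^] (1::int) \<otimes> (c [^] ?\<alpha> \<otimes> c [^] (-1::int))))"
    unfolding A.pow_pow_conj b_\<alpha> by (simp add: m_assoc)
  also have "c [^] (1::int) \<otimes> (c [^] ?\<alpha> \<otimes> c [^] (-1::int)) = c [^] ?\<alpha>"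
    by (simp flip: int_pow_mult del: int_pow_1)
  finally have "a \<otimes> c [^] ?\<alpha> \<otimes> b [^] (?\<alpha> - ?S) = a [^] (?S * conj_exp s l (-1)) \<otimes> c [^] ?\<alpha>"
    by simp
  then have "b [^] (?\<alpha> - ?S) = inv (a [^] (1::int) \<otimes> c [^] ?\<alpha>) \<otimes> (a [^] (?S * conj_exp s l (-1)) \<otimes> c [^] ?\<alpha>)"
    by (simp add: inv_solve_left)
  also have "\<dots> = a [^] (- conj_exp s l ?\<alpha> + ?S * conj_exp s l (-1) * conj_exp s l ?\<alpha>)"
    unfolding A.pow_conj_pow by (simp add: inv_mult_group m_assoc int_pow_mult int_pow_neg
        del: uminus_add_conv_diff)
      (simp flip: m_assoc)
  finally have rel: "b [^] (?\<alpha> - ?S) = a [^] (- conj_exp s l ?\<alpha> + ?S * conj_exp s l (-1) * conj_exp s l ?\<alpha>)" .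
  have phi_\<alpha>: "phi ?\<alpha> = s * l * ?\<alpha>"
    using two_phi[of ?\<alpha>] by simp
  have "?\<alpha> * (?\<alpha> + 1) * (?\<alpha> - 1) = 2 * s * (2 * l * ?\<alpha> * (1 + s * l))"
    by algebra
  then obtain v where v: "varphi ?\<alpha> + phi ?\<alpha> = s * v"
    by (rule s_dvd_varphi)
  \<comment> \<open>The names \<open>q\<close>, \<open>h\<close> and \<open>r\<close> collect the higher terms, so that each exponent is visibly its expansion in
    \<open>s\<close> up to an explicit multiple of \<open>4 s\<^sup>3\<close>.\<close>
  define q where "q = l ^ 2 * v - l ^ 3"
  have S: "?S = ?\<alpha> - 2 * s ^ 2 * l ^ 2 + 4 * s ^ 3 * q"
    unfolding power_exp_1 v unfolding phi_\<alpha> q_def by algebra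
  have b_eq: "b [^] (?\<alpha> - ?S) = b [^] (2 * s ^ 2 * l ^ 2)"
    by (rule B.pow_cong) (simp add: S)
  have "phi (- 1) = 1" by (simp add: phi_def)
  then have Em: "conj_exp s l (-1) = 1 - 2 * s * l + 4 * s ^ 2 * l ^ 2"
    by (simp add: conj_exp_def)
  define h where "h = l * ?\<alpha> + 2 * s * l ^ 2 * phi ?\<alpha>"
  have Ea: "conj_exp s l ?\<alpha> = 1 + 2 * s * h"
    unfolding conj_exp_def h_def by algebra
  define r where "r = q * conj_exp s l (-1) + 3 * l ^ 3 - 2 * s * l ^ 4"
  have "- conj_exp s l ?\<alpha> + ?S * conj_exp s l (-1) * conj_exp s l ?\<alpha> - (- (2 * s ^ 2 * l ^ 2))
      = 4 * s ^ 3 * (r * (1 + 2 * s * h) - l ^ 2 * h)"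
    unfolding Ea S r_def unfolding Em by algebra
  then have "a [^] (- conj_exp s l ?\<alpha> + ?S * conj_exp s l (-1) * conj_exp s l ?\<alpha>) = a [^] (- (2 * s ^ 2 * l ^ 2))"
    by (intro A.pow_cong) simp
  with rel b_eq have "b [^] (2 * s ^ 2 * l ^ 2) = a [^] (- (2 * s ^ 2 * l ^ 2))" by simp
  then show ?thesis by (simp add: z_def int_pow_neg)
qed

lemma a_pow_z: "a [^] (2 * s ^ 2 * l ^ 2 * k) = z [^] k" for k :: int
  by (simp add: z_def int_pow_pow)

lemma b_pow_z: "b [^] (2 * s ^ 2 * l ^ 2 * k) = z [^] (- k)" for k :: int
  by (simp add: z_eq_b_pow int_pow_pow)

text \<open>As a power of \<open>a\<close> and also of \<open>b\<close>, the element \<open>z\<close> commutes with both generators, so it is central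
  in the subgroup that they generate.\<close>

lemma z_commute:
  fixes i j :: int
  shows "z [^] i \<otimes> a [^] j = a [^] j \<otimes> z [^] i"
    and "z [^] i \<otimes> b [^] j = b [^] j \<otimes> z [^] i"
    and "z [^] i \<otimes> c [^] j = c [^] j \<otimes> z [^] i"
proof -
  show a: "z [^] i \<otimes> a [^] j = a [^] j \<otimes> z [^] i" for i j :: int
    unfolding a_pow_z[symmetric] by (simp add: add.commute flip: int_pow_mult)
  show b: "z [^] i \<otimes> b [^] j = b [^] j \<otimes> z [^] i" for i j :: int
  proof -
    have "z [^] i = b [^] (2 * s ^ 2 * l ^ 2 * (- i))"
      by (simp only: b_pow_z minus_minus)
    then show ?thesis by (simp add: add.commute flip: int_pow_mult)
  qed
  have "z \<otimes> c = c \<otimes> a [^] (2 * s ^ 2 * l ^ 2 * (1 + 2 * s * l))"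
    using int_pow_conj[OF _ _ _ conj_a, of "2 * s ^ 2 * l ^ 2"]
    by (simp add: z_def int_pow_pow mult.commute)
  also have "a [^] (2 * s ^ 2 * l ^ 2 * (1 + 2 * s * l)) = z"
    unfolding z_def
  proof (rule A.pow_cong)
    have "2 * s ^ 2 * l ^ 2 * (1 + 2 * s * l) - 2 * s ^ 2 * l ^ 2 = 4 * s ^ 3 * l ^ 3"
      by algebra
    then show "4 * s ^ 3 dvd 2 * s ^ 2 * l ^ 2 * (1 + 2 * s * l) - 2 * s ^ 2 * l ^ 2"
      by simp
  qed
  finally show "z [^] i \<otimes> c [^] j = c [^] j \<otimes> z [^] i"
    by (simp add: int_pow_commute)
qed

lemma z_left_commute:
  fixes i j :: int
  assumes "y \<in> carrier G"
  shows "z [^] i \<otimes> (a [^] j \<otimes> y) = a [^] j \<otimes> (z [^] i \<otimes> y)"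
    and "z [^] i \<otimes> (b [^] j \<otimes> y) = b [^] j \<otimes> (z [^] i \<otimes> y)"
    and "z [^] i \<otimes> (c [^] j \<otimes> y) = c [^] j \<otimes> (z [^] i \<otimes> y)"
  using assms z_commute[of i j] by (simp_all flip: m_assoc)

section \<open>Collection in the subgroup of class three\<close>

text \<open>For powers of \<open>b ^ (2 s l)\<close> and \<open>c ^ (2 s l)\<close> the corrections in \<open>power_exp\<close> and \<open>conj_exp\<close> begin with the
  quadratic terms in \<open>s\<close>, which yield powers of the central element \<open>z\<close>; the cubic terms are
  multiples of \<open>4 s\<^sup>3\<close> and vanish.\<close>

lemma b_pow_a_collect:
  "b [^] (2 * s * l * k) \<otimes> a
    = a \<otimes> (b [^] (2 * s * l * k) \<otimes> (c [^] (- (2 * s * l * k)) \<otimes> z [^] (- k)))" for k :: int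
proof -
  let ?n = "2 * s * l * k"
  have phi_n: "phi ?n = s * l * k * (?n - 1)"
    using two_phi[of ?n] by simp
  have "?n * (?n + 1) * (?n - 1) = 2 * s * (l * k * (?n + 1) * (?n - 1))"
    by algebra
  then obtain v where v: "varphi ?n + phi ?n = s * v"
    by (rule s_dvd_varphi)
  have "power_exp s l 1 ?n - (?n + 2 * s ^ 2 * l ^ 2 * k) = 4 * s ^ 3 * (l ^ 2 * v - l ^ 3 * k ^ 2)"
    unfolding power_exp_1 v unfolding phi_n by algebra
  then have "b [^] power_exp s l 1 ?n = b [^] (?n + 2 * s ^ 2 * l ^ 2 * k)"
    by (intro B.pow_cong) simp
  also have "\<dots> = b [^] ?n \<otimes> z [^] (- k)"
    by (simp only: int_pow_mult b b_pow_z)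
  finally show ?thesis
    unfolding b_pow_a by (simp add: m_assoc z_commute)
qed

lemma b_pow_c_collect:
  "b [^] (2 * s * l * k) \<otimes> c [^] t = c [^] t \<otimes> (b [^] (2 * s * l * k) \<otimes> z [^] (2 * k * t))"
  for k t :: int
proof -
  let ?n = "2 * s * l * k"
  have "?n * conj_exp s l (- t) - (?n + 2 * s ^ 2 * l ^ 2 * (- (2 * k * t)))
      = 4 * s ^ 3 * (2 * l ^ 3 * k * phi (- t))"
    unfolding conj_exp_def by algebra
  then have "b [^] (?n * conj_exp s l (- t)) = b [^] (?n + 2 * s ^ 2 * l ^ 2 * (- (2 * k * t)))"
    by (intro B.pow_cong) simp
  also have "\<dots> = b [^] ?n \<otimes> z [^] (2 * k * t)"
    by (simp only: int_pow_mult b b_pow_z minus_minus)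
  finally show ?thesis
    using B.pow_conj_pow[of ?n "- t"] by (simp add: inv_c_pow)
qed

lemma c_pow_a_collect:
  "c [^] (- (2 * s * l * k)) \<otimes> a = a \<otimes> (c [^] (- (2 * s * l * k)) \<otimes> z [^] (2 * k))" for k :: int
proof -
  let ?n = "2 * s * l * k"
  have phi_n: "phi ?n = s * l * k * (?n - 1)"
    using two_phi[of ?n] by simp
  have "conj_exp s l ?n - (1 + 2 * s ^ 2 * l ^ 2 * (2 * k)) = 4 * s ^ 3 * (l ^ 3 * k * (?n - 1))"
    unfolding conj_exp_def phi_n by algebra
  then have "a [^] conj_exp s l ?n = a [^] (1 + 2 * s ^ 2 * l ^ 2 * (2 * k))"
    by (intro A.pow_cong) simp
  also have "\<dots> = a \<otimes> z [^] (2 * k)"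
    by (simp only: int_pow_mult a a_pow_z int_pow_1)
  finally show ?thesis
    using A.pow_pow_conj[of "- ?n" 1] by (simp add: m_assoc z_commute)
qed

lemma a_conj_b_pow:
  "a \<otimes> b [^] t = b [^] t \<otimes>
    ((a \<otimes> c [^] t) \<otimes> b [^] (2 * s * l * phi t) \<otimes> z [^] (2 * varphi (t + 1)))" for t :: int
proof -
  have "t - power_exp s l 1 t = 2 * s * l * phi t + 2 * s ^ 2 * l ^ 2 * (- (2 * varphi (t + 1)))"
    unfolding power_exp_1 varphi_Suc by algebra
  then have "b [^] (t - power_exp s l 1 t) = b [^] (2 * s * l * phi t) \<otimes> z [^] (2 * varphi (t + 1))"
    by (simp only: int_pow_mult b b_pow_z minus_minus)
  then show ?thesis
    using a_b_pow[of t] by (simp add: m_assoc)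
qed

text \<open>This is \<open>int_pow_mult_collect\<close> for \<open>X = a c ^ t\<close> and \<open>Y = b ^ (2 s l k)\<close>. The term \<open>2 k t n\<^sup>2\<close> in the exponent
  of \<open>z\<close> comes from moving \<open>c ^ (t n)\<close>, a factor of \<open>X ^ n\<close>, to the right of \<open>Y ^ n\<close>.\<close>

lemma collected_pow:
  fixes n k t :: int
  shows "((a \<otimes> c [^] t) \<otimes> b [^] (2 * s * l * k)) [^] n
    = a [^] power_exp s l t n \<otimes> (b [^] (2 * s * l * (n * k)) \<otimes> (c [^] (n * t - 2 * s * l * phi n * k)
       \<otimes> z [^] (k * (2 * t - 1) * phi n + 2 * k * varphi n - 2 * k * t * n ^ 2)))"
proof -
  let ?n = "2 * s * l * k"
  define X where "X = a \<otimes> c [^] t"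
  define Y where "Y = b [^] ?n"
  define W where "W = c [^] (- ?n) \<otimes> z [^] (k * (2 * t - 1))"
  define Z where "Z = z [^] (2 * k)"
  have z_add: "z [^] i \<otimes> z [^] j = z [^] (i + j)" for i j :: int
    by (simp add: int_pow_mult)
  have c_add: "c [^] i \<otimes> c [^] j = c [^] (i + j)" for i j :: int
    by (simp add: int_pow_mult)
  have c_left: "c [^] i \<otimes> (c [^] j \<otimes> y) = c [^] j \<otimes> (c [^] i \<otimes> y)"
    if "y \<in> carrier G" for i j :: int and y
    using that by (simp add: c_add add.commute flip: m_assoc)
  note z_a = z_commute(1)[of _ 1, simplified] z_left_commute(1)[of _ _ 1, simplified]
  note z_simps = m_assoc z_commute(2,3) z_left_commute(2,3) z_a
  have "Y \<otimes> X = (b [^] ?n \<otimes> a) \<otimes> c [^] t"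
    by (simp add: X_def Y_def m_assoc)
  also have "\<dots> = a \<otimes> ((b [^] ?n \<otimes> c [^] t) \<otimes> (c [^] (- ?n) \<otimes> z [^] (- k)))"
    unfolding b_pow_a_collect
    by (simp add: z_simps c_left[of _ "- (2 * s * l * k)" t])
  also have "\<dots> = X \<otimes> (Y \<otimes> (c [^] (- ?n) \<otimes> (z [^] (2 * k * t) \<otimes> z [^] (- k))))"
    unfolding b_pow_c_collect by (simp add: z_simps X_def Y_def)
  also have "\<dots> = X \<otimes> (Y \<otimes> W)"
    unfolding z_add W_def by (simp add: algebra_simps)
  finally have YX: "Y \<otimes> X = X \<otimes> (Y \<otimes> W)" .
  have "W \<otimes> X = (c [^] (- ?n) \<otimes> a) \<otimes> (c [^] t \<otimes> z [^] (k * (2 * t - 1)))"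
    by (simp add: z_simps W_def X_def)
  also have "\<dots> = X \<otimes> (W \<otimes> Z)"
    unfolding c_pow_a_collect
    by (simp add: z_simps W_def X_def Z_def c_left[of _ "- (2 * s * l * k)" t])
      (simp add: z_add add.commute)
  finally have WX: "W \<otimes> X = X \<otimes> (W \<otimes> Z)" .
  \<comment> \<open>Commuting \<open>Y\<close> with \<open>c ^ (- 2 s l k)\<close> costs a power of \<open>z\<close> of exponent divisible by \<open>2 s\<close>, which is trivial.\<close>
  have "z [^] (2 * k * (- ?n)) = a [^] (4 * s ^ 3 * (- (2 * l ^ 3 * k ^ 2)))"
    unfolding a_pow_z[symmetric] by (rule arg_cong[where f="\<lambda>i. a [^] i"]) algebra
  also have "\<dots> = \<one>"
    using A.pow_cong[of "4 * s ^ 3 * (- (2 * l ^ 3 * k ^ 2))" 0] by simp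
  finally have "Y \<otimes> c [^] (- ?n) = c [^] (- ?n) \<otimes> Y"
    unfolding Y_def b_pow_c_collect by simp
  then have WY: "W \<otimes> Y = Y \<otimes> W"
    unfolding W_def by (simp add: z_simps Y_def) (simp flip: m_assoc)
  have Z_com: "Z \<otimes> X = X \<otimes> Z" "Z \<otimes> Y = Y \<otimes> Z" "Z \<otimes> W = W \<otimes> Z"
    by (simp_all add: Z_def X_def Y_def W_def z_simps)
      (simp add: z_add add.commute)
  have closed: "X \<in> carrier G" "Y \<in> carrier G" "W \<in> carrier G" "Z \<in> carrier G"
    by (simp_all add: X_def Y_def W_def Z_def)
  have W_pow: "W [^] j = c [^] (- ?n * j) \<otimes> z [^] (k * (2 * t - 1) * j)" for j :: int
    unfolding W_def by (simp add: int_pow_mult_distrib z_commute int_pow_pow)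
  have Y_pow: "Y [^] n = b [^] (2 * s * l * (n * k))"
    by (simp add: Y_def int_pow_pow ac_simps)
  have cY: "c [^] (t * n) \<otimes> b [^] (2 * s * l * (n * k))
     = b [^] (2 * s * l * (n * k)) \<otimes> c [^] (t * n) \<otimes> z [^] (- (2 * k * t * n ^ 2))"
    unfolding b_pow_c_collect
    by (simp add: m_assoc z_add) (simp add: power2_eq_square ac_simps)
  have "(X \<otimes> Y) [^] n = X [^] n \<otimes> (Y [^] n \<otimes> (W [^] phi n \<otimes> Z [^] varphi n))"
    by (rule int_pow_mult_collect) (fact closed YX WY WX Z_com)+
  also have "\<dots> = a [^] power_exp s l t n \<otimes> ((c [^] (t * n) \<otimes> b [^] (2 * s * l * (n * k)))
      \<otimes> (c [^] (- ?n * phi n) \<otimes> (z [^] (k * (2 * t - 1) * phi n) \<otimes> z [^] (2 * k * varphi n))))"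
    unfolding X_def A.mult_pow W_pow Y_pow Z_def by (simp add: m_assoc int_pow_pow)
  also have "\<dots> = a [^] power_exp s l t n \<otimes> (b [^] (2 * s * l * (n * k)) \<otimes>
      ((c [^] (t * n) \<otimes> c [^] (- ?n * phi n)) \<otimes> ((z [^] (k * (2 * t - 1) * phi n) \<otimes> z [^] (2 * k * varphi n))
         \<otimes> z [^] (- (2 * k * t * n ^ 2)))))"
    unfolding cY z_add by (simp add: z_simps) (simp add: z_add add.commute)
  finally show ?thesis
    unfolding c_add z_add X_def Y_def by (simp add: algebra_simps)
qed

section \<open>Commutators of powers\<close>

lemma commutator_c_pow_b_pow:
  "commutator G (c [^] n) (b [^] t) = b [^] (2 * s * l * n * t - 4 * s ^ 2 * l ^ 2 * phi (n + 1) * t)"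
  for n t :: int
proof -
  have "phi (- n) = phi (n + 1)"
    using two_phi[of "- n"] two_phi[of "n + 1"] by (simp add: algebra_simps)
  then have "t * (1 - conj_exp s l (- n)) = 2 * s * l * n * t - 4 * s ^ 2 * l ^ 2 * phi (n + 1) * t"
    by (simp add: conj_exp_def algebra_simps)
  then show ?thesis
    using B.commutator_pow[of "- n" t] by (simp add: inv_c_pow)
qed

text \<open>Conjugation by \<open>b ^ t\<close> takes \<open>a ^ n\<close> to the \<open>n\<close>-th power of \<open>a c ^ t Y z'\<close>, where \<open>Y\<close> and the power \<open>z'\<close>
  of \<open>z\<close> are the last two factors in \<open>a_conj_b_pow\<close>, and \<open>collected_pow\<close> evaluates that \<open>n\<close>-th power; the quadratic part of \<open>power_exp s l t n\<close> contributes a further power of \<open>z\<close>.\<close>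

lemma commutator_a_pow_b_pow:
  fixes n t :: int
  defines "e \<equiv> 2 * varphi (n + 1) * t + (2 * n - 7) * phi n * phi t
    - 2 * n * phi t - (3 * n + 1) * n * varphi t"
  shows "commutator G (a [^] n) (b [^] t)
    = a [^] (- 2 * s * l * phi n * t) \<otimes> b [^] (2 * s * l * n * phi t)
      \<otimes> c [^] (n * t - 2 * s * l * phi n * phi t) \<otimes> a [^] (2 * s ^ 2 * l ^ 2 * e)"
proof -
  have z_add: "z [^] i \<otimes> z [^] j = z [^] (i + j)" for i j :: int
    by (simp add: int_pow_mult)
  note z_a = z_commute(1)[of _ 1, simplified] z_left_commute(1)[of _ _ 1, simplified]
  note z_simps = m_assoc z_commute z_left_commute z_a
  have move: "a [^] i \<otimes> z [^] p \<otimes> b [^] j \<otimes> c [^] k \<otimes> z [^] q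
      = a [^] i \<otimes> b [^] j \<otimes> c [^] k \<otimes> z [^] (p + q)" for i j k p q :: int
    by (simp add: z_simps z_add)
  define P where "P = (a \<otimes> c [^] t) \<otimes> b [^] (2 * s * l * phi t)"
  define v where "v = 2 * varphi (t + 1)"
  have P: "P \<in> carrier G" by (simp add: P_def)
  have zP: "P \<otimes> z [^] v = z [^] v \<otimes> P"
    by (simp add: P_def z_simps)
  have "a \<otimes> b [^] t = b [^] t \<otimes> (P \<otimes> z [^] v)"
    unfolding P_def v_def by (rule a_conj_b_pow)
  then have "a [^] n \<otimes> b [^] t = b [^] t \<otimes> (P \<otimes> z [^] v) [^] n"
    using P by (intro int_pow_conj) simp_all
  also have "(P \<otimes> z [^] v) [^] n = P [^] n \<otimes> z [^] (v * n)"
    using int_pow_mult_distrib[OF zP] P by (simp add: int_pow_pow)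
  finally have "commutator G (a [^] n) (b [^] t) = a [^] (- n) \<otimes> (P [^] n \<otimes> z [^] (v * n))"
    using P by (simp add: commutator_def m_assoc int_pow_neg)
       (simp flip: m_assoc)
  also have "\<dots> = a [^] (- n) \<otimes> a [^] power_exp s l t n \<otimes> b [^] (2 * s * l * (n * phi t))
       \<otimes> c [^] (n * t - 2 * s * l * phi n * phi t)
       \<otimes> z [^] (phi t * (2 * t - 1) * phi n + 2 * phi t * varphi n - 2 * phi t * t * n ^ 2 + v * n)"
    unfolding P_def collected_pow by (simp add: m_assoc z_add)
  also have "a [^] (- n) \<otimes> a [^] power_exp s l t n
      = a [^] (- 2 * s * l * phi n * t + 2 * s ^ 2 * l ^ 2 * (2 * (t ^ 2 * varphi n + phi (t + 1) * phi n)))"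
    unfolding int_pow_mult[OF a, symmetric] power_exp_def
    by (rule arg_cong[where f = "\<lambda>i. a [^] i"]) algebra
  also have "\<dots> = a [^] (- 2 * s * l * phi n * t) \<otimes> z [^] (2 * (t ^ 2 * varphi n + phi (t + 1) * phi n))"
    by (simp only: int_pow_mult a a_pow_z)
  also have "b [^] (2 * s * l * (n * phi t)) = b [^] (2 * s * l * n * phi t)"
    by (simp only: mult.assoc)
  finally have "commutator G (a [^] n) (b [^] t) =
      a [^] (- 2 * s * l * phi n * t) \<otimes> b [^] (2 * s * l * n * phi t)
      \<otimes> c [^] (n * t - 2 * s * l * phi n * phi t)
      \<otimes> z [^] (2 * (t ^ 2 * varphi n + phi (t + 1) * phi n) +
        (phi t * (2 * t - 1) * phi n + 2 * phi t * varphi n - 2 * phi t * t * n ^ 2 + v * n))"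
    by (simp only: move)
  also have "2 * (t ^ 2 * varphi n + phi (t + 1) * phi n) +
        (phi t * (2 * t - 1) * phi n + 2 * phi t * varphi n - 2 * phi t * t * n ^ 2 + v * n) = e"
  proof -
    \<comment> \<open>Multiplied by twelve, both sides become polynomials in \<open>n\<close> and \<open>t\<close> with integer coefficients.\<close>
    have "2 * phi n = (n - 1) * n" "2 * phi t = (t - 1) * t"
      "6 * varphi n = n * (n - 1) * (n - 2)" "6 * varphi t = t * (t - 1) * (t - 2)"
      by (rule two_phi six_varphi)+
    then have "12 * (2 * (t ^ 2 * varphi n + (phi t + t) * phi n) +
        (phi t * (2 * t - 1) * phi n + 2 * phi t * varphi n - 2 * phi t * t * n ^ 2
          + 2 * (varphi t + phi t) * n))
      = 12 * (2 * (varphi n + phi n) * t + (2 * n - 7) * phi n * phi t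
    - 2 * n * phi t - (3 * n + 1) * n * varphi t)"
      by algebra
    then show ?thesis unfolding e_def v_def phi_Suc varphi_Suc
      by (rule mult_left_cancel[THEN iffD1, rotated]) simp
  qed
  finally show ?thesis by (simp only: a_pow_z)
qed

end

section \<open>The presented group satisfies its relations\<close>

lemma (in group) subset_normal_closure:
  "R \<subseteq> carrier G \<Longrightarrow> R \<subseteq> normal_closure G R"
  by (auto simp: normal_closure_def)

lemma presented_hom:
  assumes "R \<subseteq> carrier free_group"
  shows "group_hom free_group (presented_group R) (\<lambda>w. normal_closure free_group R #>\<^bsub>free_group\<^esub> w)"
proof -
  interpret normal "normal_closure free_group R" free_group
    by (rule group.normal_normal_closure[OF group_free_group assms])
  show ?thesis
    unfolding group_hom_def group_hom_axioms_def
    using r_coset_hom_Mod assms group_free_group group_presented_group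
    by (auto simp: presented_group_def)
qed

lemma presented_relator:
  assumes "R \<subseteq> carrier free_group" and "r \<in> R"
  shows "normal_closure free_group R #>\<^bsub>free_group\<^esub> r = \<one>\<^bsub>presented_group R\<^esub>"
proof -
  interpret normal "normal_closure free_group R" free_group
    by (rule group.normal_normal_closure[OF group_free_group assms(1)])
  have "r \<in> normal_closure free_group R"
    using assms group.subset_normal_closure[OF group_free_group] by blast
  then show ?thesis
    using rcos_const by (simp add: presented_group_def FactGroup_def)
qed

lemma (in group_hom) hom_commutator:
  "x \<in> carrier G \<Longrightarrow> y \<in> carrier G \<Longrightarrow> h (commutator G x y) = commutator H (h x) (h y)"
  by (simp add: commutator_def)

lemma (in group_hom) hom_conjugate_by:
  "x \<in> carrier G \<Longrightarrow> y \<in> carrier G \<Longrightarrow> h (conjugate_by G x y) = conjugate_by H (h x) (h y)"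
  by (simp add: conjugate_by_def)

lemma (in group) commutator_closed [simp]:
  "x \<in> carrier G \<Longrightarrow> y \<in> carrier G \<Longrightarrow> commutator G x y \<in> carrier G"
  by (simp add: commutator_def)

lemma (in group) conjugate_by_closed [simp]:
  "x \<in> carrier G \<Longrightarrow> y \<in> carrier G \<Longrightarrow> conjugate_by G x y \<in> carrier G"
  by (simp add: conjugate_by_def)

lemma (in group) inv_commutator:
  "x \<in> carrier G \<Longrightarrow> y \<in> carrier G \<Longrightarrow> inv (commutator G x y) = commutator G y x"
  by (simp add: commutator_def inv_mult_group m_assoc)

lemma J_relations:
  fixes m :: nat and l :: int
  defines "J \<equiv> J_group m l" and "A \<equiv> J_A m l" and "B \<equiv> J_B m l"
  shows "conjugate_by J A (commutator J A B) = A [^]\<^bsub>J\<^esub> alpha m l"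
    and "conjugate_by J B (commutator J B A) = B [^]\<^bsub>J\<^esub> alpha m l"
    and "A [^]\<^bsub>J\<^esub> ((2::nat) ^ (3 * m - 1)) = \<one>\<^bsub>J\<^esub>"
    and "B [^]\<^bsub>J\<^esub> ((2::nat) ^ (3 * m - 1)) = \<one>\<^bsub>J\<^esub>"
proof -
  let ?R = "J_relators m l" and ?F = "free_group :: gen word set monoid"
  define h where "h = (\<lambda>w. normal_closure ?F ?R #>\<^bsub>?F\<^esub> w)"
  interpret group_hom ?F J h
    unfolding h_def J_def J_group_def by (rule presented_hom[OF J_relators_closed])
  have h_gen: "h (free_gen Gen_A) = A" "h (free_gen Gen_B) = B"
    by (simp_all add: h_def A_def B_def J_A_def J_B_def presented_gen_def)
  have one: "h r = \<one>\<^bsub>J\<^esub>" if "r \<in> ?R" for r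
    using presented_relator[OF J_relators_closed that] by (simp add: h_def J_def J_group_def)
  have closed [simp]: "free_gen g \<in> carrier ?F" for g
    by (rule free_gen_closed)
  have AB [simp]: "A \<in> carrier J" "B \<in> carrier J"
    using hom_closed[OF closed] h_gen by metis+
  have eq: "x = y" if "x \<otimes>\<^bsub>J\<^esub> inv\<^bsub>J\<^esub> y = \<one>\<^bsub>J\<^esub>" "x \<in> carrier J" "y \<in> carrier J" for x y
    using that by (metis H.inv_closed H.inv_equality H.inv_inv)
  note in_R = J_relators_def Let_def
  note hom = hom_commutator hom_conjugate_by hom_int_pow hom_nat_pow h_gen
  show "conjugate_by J A (commutator J A B) = A [^]\<^bsub>J\<^esub> alpha m l"
    using one[of "conjugate_by ?F (free_gen Gen_A) (commutator ?F (free_gen Gen_A) (free_gen Gen_B))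
       \<otimes>\<^bsub>?F\<^esub> inv\<^bsub>?F\<^esub> (free_gen Gen_A [^]\<^bsub>?F\<^esub> alpha m l)"]
    by - (rule eq, simp_all add: in_R hom)
  show "conjugate_by J B (commutator J B A) = B [^]\<^bsub>J\<^esub> alpha m l"
    using one[of "conjugate_by ?F (free_gen Gen_B) (commutator ?F (free_gen Gen_B) (free_gen Gen_A))
       \<otimes>\<^bsub>?F\<^esub> inv\<^bsub>?F\<^esub> (free_gen Gen_B [^]\<^bsub>?F\<^esub> alpha m l)"]
    by - (rule eq, simp_all add: in_R hom)
  show "A [^]\<^bsub>J\<^esub> ((2::nat) ^ (3 * m - 1)) = \<one>\<^bsub>J\<^esub>"
    using one[of "free_gen Gen_A [^]\<^bsub>?F\<^esub> ((2::nat) ^ (3 * m - 1))"] by (simp add: in_R hom)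
  show "B [^]\<^bsub>J\<^esub> ((2::nat) ^ (3 * m - 1)) = \<one>\<^bsub>J\<^esub>"
    using one[of "free_gen Gen_B [^]\<^bsub>?F\<^esub> ((2::nat) ^ (3 * m - 1))"] by (simp add: in_R hom)
qed

text \<open>Since \<open>3 m - 1 = 2 + 3 (m - 1)\<close> for \<open>m \<ge> 1\<close>, the exponent in the last two relations is \<open>4 s\<^sup>3\<close>
  with \<open>s = 2 ^ (m - 1)\<close>.\<close>

lemma macdonald_pair_J:
  assumes "m \<ge> 1"
  shows "macdonald_pair (J_group m l) (J_A m l) (J_B m l) (J_C m l) (2 ^ (m - 1)) l"
proof -
  let ?J = "J_group m l" and ?A = "J_A m l" and ?B = "J_B m l" and ?C = "J_C m l"
  interpret group ?J by (rule group_J_group)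
  have A: "?A \<in> carrier ?J" and B: "?B \<in> carrier ?J"
    by (simp_all add: J_A_def J_B_def J_group_def presented_gen_closed)
  then have C: "?C \<in> carrier ?J"
    by (simp add: J_C_def)
  have alpha: "alpha m l = 1 + 2 * 2 ^ (m - 1) * l"
    using assms by (simp add: alpha_def flip: power_Suc)
  have N: "4 * (2 ^ (m - 1)) ^ 3 = int (2 ^ (3 * m - 1))"
  proof -
    have "3 * m - 1 = 2 + (m - 1) * 3" using assms by simp
    then have "int (2 ^ (3 * m - 1)) = 2 ^ 2 * (2 ^ (m - 1)) ^ 3"
      by (simp only: power_add power_mult of_nat_power of_nat_mult of_nat_numeral)
    then show ?thesis by simp
  qed
  have conj: "x \<otimes>\<^bsub>?J\<^esub> g = g \<otimes>\<^bsub>?J\<^esub> y"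
    if "conjugate_by ?J x g = y" "x \<in> carrier ?J" "g \<in> carrier ?J" for x g y
    using that(2,3) unfolding that(1)[symmetric] conjugate_by_def
    by (simp add: m_assoc) (simp flip: m_assoc)
  have inv_C: "commutator ?J ?B ?A = inv\<^bsub>?J\<^esub> ?C"
    using A B by (simp add: J_C_def inv_commutator)
  show ?thesis
  proof unfold_locales
    show "?A \<otimes>\<^bsub>?J\<^esub> ?C = ?C \<otimes>\<^bsub>?J\<^esub> ?A [^]\<^bsub>?J\<^esub> (1 + 2 * 2 ^ (m - 1) * l)"
      using J_relations(1)[of m l] A C unfolding J_C_def[symmetric] alpha by (rule conj)
    show "?B \<otimes>\<^bsub>?J\<^esub> inv\<^bsub>?J\<^esub> ?C = inv\<^bsub>?J\<^esub> ?C \<otimes>\<^bsub>?J\<^esub> ?B [^]\<^bsub>?J\<^esub> (1 + 2 * 2 ^ (m - 1) * l)"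
      using J_relations(2)[of m l] B inv_closed[OF C] unfolding inv_C alpha by (rule conj)
    show "?A [^]\<^bsub>?J\<^esub> (4 * (2 ^ (m - 1)) ^ 3 :: int) = \<one>\<^bsub>?J\<^esub>"
      unfolding N int_pow_int by (rule J_relations)
    show "?B [^]\<^bsub>?J\<^esub> (4 * (2 ^ (m - 1)) ^ 3 :: int) = \<one>\<^bsub>?J\<^esub>"
      unfolding N int_pow_int by (rule J_relations)
    show "coprime (2 ^ (m - 1)) (3 :: int)"
      by (simp add: coprime_power_left_iff)
  qed (use A B in \<open>simp_all add: J_C_def\<close>)
qed

theorem theorem3p1:
  fixes m :: nat and l s u :: int
    and J (structure)
    and A B C :: "gen word set set"
  assumes "m \<ge> 1" and "odd l"
    and "s = 2 ^ (m - 1)" and "u = s ^ 2"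
    and "J = J_group m l" and "A = J_A m l" and "B = J_B m l" and "C = J_C m l"
  shows "\<forall>n t :: int.
      commutator J (C [^] n) (A [^] t)
        = A [^] (- 2 * s * l * n * t - 4 * u * l ^ 2 * phi n * t)
    \<and> commutator J (C [^] n) (B [^] t)
        = B [^] (2 * s * l * n * t - 4 * u * l ^ 2 * phi (n + 1) * t)
    \<and> commutator J (A [^] n) (B [^] t)
        = A [^] (- 2 * s * l * phi n * t) \<otimes> B [^] (2 * s * l * n * phi t)
          \<otimes> C [^] (n * t - 2 * s * l * phi n * phi t) \<otimes> A [^] xi1 m l n t"
proof (intro allI conjI)
  fix n t :: int
  interpret macdonald_pair J A B C s l
    using macdonald_pair_J[of m l] assms by simp
  have "t * (1 - conj_exp s l n) = - 2 * s * l * n * t - 4 * u * l ^ 2 * phi n * t"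
    unfolding conj_exp_def \<open>u = s ^ 2\<close> by algebra
  then show "commutator J (C [^] n) (A [^] t)
      = A [^] (- 2 * s * l * n * t - 4 * u * l ^ 2 * phi n * t)"
    using A.commutator_pow by simp
  show "commutator J (C [^] n) (B [^] t)
      = B [^] (2 * s * l * n * t - 4 * u * l ^ 2 * phi (n + 1) * t)"
    unfolding \<open>u = s ^ 2\<close> by (rule commutator_c_pow_b_pow)
  have "xi1 m l n t = 2 * s ^ 2 * l ^ 2 * (2 * varphi (n + 1) * t + (2 * n - 7) * phi n * phi t
      - 2 * n * phi t - (3 * n + 1) * n * varphi t)"
    unfolding xi1_def Let_def \<open>s = 2 ^ (m - 1)\<close> ..
  then show "commutator J (A [^] n) (B [^] t)
        = A [^] (- 2 * s * l * phi n * t) \<otimes> B [^] (2 * s * l * n * phi t)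
          \<otimes> C [^] (n * t - 2 * s * l * phi n * phi t) \<otimes> A [^] xi1 m l n t"
    by (simp only: commutator_a_pow_b_pow)
qed

end
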